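(* Let $J$ be a finite set and let $\varphi\colon 2^J\to\mathbb{R}$ be an arbitrary set function with $\varphi(\emptyset)=0$. Then there exist infinite-alternating set functions $\varphi_1,\varphi_2\colon 2^J\to\mathbb{R}$ such that $\varphi=\varphi_1-\varphi_2$.
   Context: For a set function $\varphi\colon 2^J\to\mathbb{R}$, a positive integer $k$ and sets $A_0,A_1,\dots,A_k\subseteq J$, let $V_\varphi(A_0;A_1,\dots,A_k)=\sum_{K\subseteq\{1,\dots,k\}}(-1)^{|K|}\varphi\bigl(A_0\cup\bigcup_{i\in K}A_i\bigr)$. The function $\varphi$ is $k$-alternating if $\varphi(\emptyset)=0$ and $V_\varphi(A_0;A_1,\dots,A_k)\le 0$ for all $A_0,A_1,\dots,A_k\subseteq J$. It is infinite-alternating if it is $k$-alternating for every positive integer $k$. *)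

theory Defs
  imports Complex_Main
begin

text \<open>
  A set function \<open>2\<^sup>J \<rightarrow> \<real>\<close> is represented by a function on \<open>'a set\<close> of which only the values
  on subsets of \<open>J\<close> matter; correspondingly, equality of two set functions on \<open>2\<^sup>J\<close> means
  agreement on all subsets of \<open>J\<close>.
\<close>

text \<open>Only the entries \<open>A 1, \<dots>, A k\<close> of the family \<open>A\<close> are used; \<open>A\<^sub>0\<close> is a separate argument.\<close>

definition V :: "('a set \<Rightarrow> real) \<Rightarrow> nat \<Rightarrow> 'a set \<Rightarrow> (nat \<Rightarrow> 'a set) \<Rightarrow> real" where
  "V \<phi> k A0 A = (\<Sum>K\<in>Pow {1..k}. (-1) ^ card K * \<phi> (A0 \<union> (\<Union>i\<in>K. A i)))"

definition alternating :: "nat \<Rightarrow> 'a set \<Rightarrow> ('a set \<Rightarrow> real) \<Rightarrow> bool" where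
  "alternating k J \<phi> \<longleftrightarrow>
     \<phi> {} = 0 \<and>
     (\<forall>A0 A. A0 \<subseteq> J \<longrightarrow> (\<forall>i\<in>{1..k}. A i \<subseteq> J) \<longrightarrow> V \<phi> k A0 A \<le> 0)"

definition infinite_alternating :: "'a set \<Rightarrow> ('a set \<Rightarrow> real) \<Rightarrow> bool" where
  "infinite_alternating J \<phi> \<longleftrightarrow> (\<forall>k\<ge>1. alternating k J \<phi>)"

end

theory Submission
  imports Defs
begin

text \<open>
  The building blocks are the hitting functions that send a set \<open>A\<close> to 1 if it meets a fixed
  set \<open>B\<close> and to 0 otherwise. Such a function is 1 minus the indicator \<open>avoids B\<close> of missing
  \<open>B\<close>, and \<open>avoids B\<close> turns unions into products. For a function with that property the
  alternating sum \<open>V\<close> factors as a product of nonnegative terms (\<open>V_multiplicative\<close>), so it is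
  nonnegative, and hitting functions are infinite-alternating (\<open>V_hits_nonpos\<close>). Their
  nonnegative combinations are then infinite-alternating too (\<open>infinite_alternating_hits_sum\<close>).

  On the other hand, the hitting functions of subsets of \<open>J\<close> span all set functions that vanish
  at the empty set (\<open>hits_sum_representation\<close>): the dual function
  \<open>\<psi> C = \<phi> J - \<phi> (J - C)\<close> has by Moebius inversion a representation
  \<open>\<psi> C = (\<Sum>B\<in>Pow C. c B)\<close>, and \<open>\<phi> A = \<psi> J - \<psi> (J - A)\<close> keeps exactly the weights \<open>c B\<close>
  of the sets \<open>B\<close> that meet \<open>A\<close>. Splitting \<open>c\<close> into its positive and negative parts
  yields the two summands.
\<close>

definition avoids :: "'a set \<Rightarrow> 'a set \<Rightarrow> real" where
  "avoids B A = of_bool (A \<inter> B = {})"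

definition hits :: "'a set \<Rightarrow> 'a set \<Rightarrow> real" where
  "hits B A = of_bool (A \<inter> B \<noteq> {})"

lemma avoids_Un: "avoids B (X \<union> Y) = avoids B X * avoids B Y"
  by (auto simp: avoids_def)

lemma avoids_Un_UNION:
  assumes "finite K"
  shows "avoids B (A0 \<union> (\<Union>i\<in>K. A i)) = avoids B A0 * (\<Prod>i\<in>K. avoids B (A i))"
  using assms by (induction K rule: finite_induct) (auto simp: avoids_Un mult.left_commute)

text \<open>Expanding \<open>\<Prod>i. (1 - g (A i))\<close> over subsets of the index set gives back the
  alternating sum, because \<open>g\<close> of a union is the product of the values of \<open>g\<close>.\<close>

lemma V_multiplicative:
  assumes "\<And>K. finite K \<Longrightarrow> g (A0 \<union> (\<Union>i\<in>K. A i)) = g A0 * (\<Prod>i\<in>K. g (A i))"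
  shows "V g k A0 A = g A0 * (\<Prod>i\<in>{1..k}. 1 - g (A i))"
proof -
  have expand: "(\<Prod>i\<in>I. 1 - g (A i)) = (\<Sum>K\<in>Pow I. (-1) ^ card K * (\<Prod>i\<in>K. g (A i)))"
    if "finite I" for I :: "nat set"
    using prod_add[OF that, of "\<lambda>i. - g (A i)" "\<lambda>_. 1"] that
    by (simp add: prod_uminus)
  have "V g k A0 A = (\<Sum>K\<in>Pow {1..k}. g A0 * ((-1) ^ card K * (\<Prod>i\<in>K. g (A i))))"
    unfolding V_def by (intro sum.cong refl) (auto simp: assms finite_subset)
  then show ?thesis
    by (simp add: expand sum_distrib_left)
qed

text \<open>The constant 1 is \<open>avoids {}\<close>, so \<open>V_multiplicative\<close> applies to both parts of
  \<open>hits B = avoids {} - avoids B\<close>. The constant contributes the product of \<open>k\<close> zeros, which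
  vanishes exactly because \<open>k\<close> is positive.\<close>

lemma V_hits_nonpos:
  assumes "k \<ge> 1"
  shows "V (hits B) k A0 A \<le> 0"
proof -
  have V_avoids: "V (avoids C) k A0 A = avoids C A0 * (\<Prod>i\<in>{1..k}. 1 - avoids C (A i))" for C
    by (rule V_multiplicative) (rule avoids_Un_UNION)
  have "V (hits B) k A0 A = V (avoids {}) k A0 A - V (avoids B) k A0 A"
    unfolding V_def sum_subtractf[symmetric]
    by (intro sum.cong refl) (simp add: hits_def avoids_def)
  also have "V (avoids {}) k A0 A = 0"
    using assms by (simp add: V_avoids avoids_def)
  also have "V (avoids B) k A0 A \<ge> 0"
    unfolding V_avoids by (intro mult_nonneg_nonneg prod_nonneg) (auto simp: avoids_def)
  finally show ?thesis by simp
qed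

lemma infinite_alternating_hits_sum:
  assumes "\<And>B. B \<in> F \<Longrightarrow> c B \<ge> 0"
  shows "infinite_alternating J (\<lambda>A. \<Sum>B\<in>F. c B * hits B A)"
proof -
  have "V (\<lambda>A. \<Sum>B\<in>F. c B * hits B A) k A0 A = (\<Sum>B\<in>F. c B * V (hits B) k A0 A)" for k A0 A
    unfolding V_def sum_distrib_left by (subst sum.swap) (simp add: mult.left_commute)
  moreover have "(\<Sum>B\<in>F. c B * V (hits B) k A0 A) \<le> 0" if "k \<ge> 1" for k A0 A
    by (intro sum_nonpos mult_nonneg_nonpos assms V_hits_nonpos that)
  ultimately show ?thesis
    by (simp add: infinite_alternating_def alternating_def hits_def)
qed

lemma hits_sum_representation:
  fixes \<phi> :: "'a set \<Rightarrow> real"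
  assumes "finite J" and "\<phi> {} = 0"
  obtains c where "\<And>A. A \<subseteq> J \<Longrightarrow> \<phi> A = (\<Sum>B\<in>Pow J. c B * hits B A)"
proof -
  define \<psi> where "\<psi> C = \<phi> J - \<phi> (J - C)" for C
  define c where "c B = (-1) ^ card B * (\<Sum>T\<in>Pow B. (-1) ^ card T * \<psi> T)" for B
  have \<psi>_eq: "\<psi> C = (\<Sum>B\<in>Pow C. c B)" if "finite C" for C
    unfolding c_def
    by (rule inclusion_exclusion_symmetric
          [where g = "\<lambda>B. \<Sum>T\<in>Pow B. (-1) ^ card T * \<psi> T", OF refl that])
  have "\<phi> A = (\<Sum>B\<in>Pow J. c B * hits B A)" if "A \<subseteq> J" for A
  proof -
    have "\<phi> A = \<psi> J - \<psi> (J - A)"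
      using that assms(2) by (simp add: \<psi>_def double_diff)
    also have "\<dots> = (\<Sum>B\<in>Pow J - Pow (J - A). c B)"
      using assms(1) by (subst sum_diff) (auto simp: \<psi>_eq)
    \<comment> \<open>The subsets of \<open>J\<close> that are not contained in \<open>J - A\<close> are those that meet \<open>A\<close>.\<close>
    also have "\<dots> = (\<Sum>B\<in>Pow J. c B * hits B A)"
      using assms(1) by (intro sum.mono_neutral_cong_left) (auto simp: hits_def)
    finally show ?thesis .
  qed
  then show ?thesis by (rule that)
qed

theorem theorem4p18:
  fixes J :: "'a set" and \<phi> :: "'a set \<Rightarrow> real"
  assumes "finite J" and "\<phi> {} = 0"
  shows "\<exists>\<phi>1 \<phi>2 :: 'a set \<Rightarrow> real.
           infinite_alternating J \<phi>1 \<and> infinite_alternating J \<phi>2 \<and>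
           (\<forall>A\<subseteq>J. \<phi> A = \<phi>1 A - \<phi>2 A)"
proof -
  obtain c where c: "\<And>A. A \<subseteq> J \<Longrightarrow> \<phi> A = (\<Sum>B\<in>Pow J. c B * hits B A)"
    using hits_sum_representation[of J \<phi>, OF assms] by metis
  define \<phi>1 where "\<phi>1 = (\<lambda>A. \<Sum>B\<in>Pow J. max (c B) 0 * hits B A)"
  define \<phi>2 where "\<phi>2 = (\<lambda>A. \<Sum>B\<in>Pow J. max (- c B) 0 * hits B A)"
  have "infinite_alternating J \<phi>1" "infinite_alternating J \<phi>2"
    unfolding \<phi>1_def \<phi>2_def by (intro infinite_alternating_hits_sum; simp)+
  moreover have "\<phi> A = \<phi>1 A - \<phi>2 A" if "A \<subseteq> J" for A
    unfolding c[OF that] \<phi>1_def \<phi>2_def sum_subtractf[symmetric]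
    by (intro sum.cong refl) (simp add: max_def)
  ultimately show ?thesis by blast
qed

end
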